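(* Let $n\ge1$, and let $p_1,\ldots,p_n$, the weights $w_1,\ldots,w_n$, the real numbers $\delta$ and $x$, and the integers $m$, $c$, $A_1,\ldots,A_n$ be as defined in the context. Then the weights $(w_i)$ and the integers $(A_i)$ induce the same strict ordering of all subset sums: for all distinct subsets $I,J\subseteq\{1,\ldots,n\}$, the sums $\sum_{i\in I}w_i$ and $\sum_{j\in J}w_j$ are different, the sums $\sum_{i\in I}A_i$ and $\sum_{j\in J}A_j$ are different, and $\sum_{i\in I}w_i<\sum_{j\in J}w_j$ if and only if $\sum_{i\in I}A_i<\sum_{j\in J}A_j$. Moreover, the integers $(A_i)$ satisfy the following properties: (1) $\sum_{i\in I}A_i<\frac12\sum_{i=1}^nA_i$ for every $I\subseteq\{1,\ldots,n\}$ with $10|I|\le n$; (2) no integer greater than $1$ divides more than $\lceil n/2\rceil$ of the $A_i$ (counted over indices $i\in\{1,\ldots,n\}$); (3) distinct subsets of $\{1,\ldots,n\}$ have distinct sums, i.e. $\sum_{i\in I}A_i\ne\sum_{j\in J}A_j$ whenever $I\ne J$; (4) no subset $I\subseteq\{1,\ldots,n\}$ satisfies $\sum_{i\in I}A_i=\left\lfloor\frac12\sum_{i=1}^nA_i\right\rfloor$.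
   Context: Setting. Let $n\ge1$ be an integer, let $X>0$ be real, and let $p_1,\ldots,p_n$ be distinct primes in the interval $[X,5X/4]$ such that, with $w_i=-\log\left(1-\frac1{p_i}\right)$, one has $$w_1\ge w_2\ge\cdots\ge w_n>0,\qquad \frac{w_1}{w_n}<\frac32.$$ (For each $n$ such primes exist once $X$ is large enough.) Put $$\delta=\min_{I\ne J}\left|\sum_{i\in I}w_i-\sum_{j\in J}w_j\right|,$$ the minimum being over all pairs of distinct subsets $I,J\subseteq\{1,\ldots,n\}$ (the empty set is allowed); it is a fact that $\delta>0$. Choose a real number $x>4n/\delta$, put $m=\lfloor n/2\rfloor$, and define $$c=\operatorname{lcm}\{\lfloor xw_i\rfloor:1\le i\le m\}$$ (with $c=1$ if $m=0$) and $$A_i=\begin{cases}c\lfloor xw_i\rfloor,& i\le m,\\ c\lfloor xw_i\rfloor+1,& i>m,\end{cases}\qquad 1\le i\le n.$$ *)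

theory Defs
  imports Complex_Main "HOL-Computational_Algebra.Primes"
begin

definition prime_weight :: "(nat \<Rightarrow> nat) \<Rightarrow> nat \<Rightarrow> real" where
  "prime_weight p i = - ln (1 - 1 / real (p i))"

definition subset_gap :: "nat \<Rightarrow> (nat \<Rightarrow> real) \<Rightarrow> real" where
  "subset_gap n w =
     Min {\<bar>(\<Sum>i\<in>I. w i) - (\<Sum>j\<in>J. w j)\<bar> | I J. I \<subseteq> {1..n} \<and> J \<subseteq> {1..n} \<and> I \<noteq> J}"

(* For m = 0 this is the Lcm of the empty set, which is 1. *)
definition common_multiple :: "nat \<Rightarrow> (nat \<Rightarrow> real) \<Rightarrow> real \<Rightarrow> int" where
  "common_multiple m w x = Lcm ((\<lambda>i. \<lfloor>x * w i\<rfloor>) ` {1..m})"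

definition int_weight :: "nat \<Rightarrow> (nat \<Rightarrow> real) \<Rightarrow> real \<Rightarrow> nat \<Rightarrow> int" where
  "int_weight n w x i =
     (let m = n div 2; c = common_multiple m w x
      in if i \<le> m then c * \<lfloor>x * w i\<rfloor> else c * \<lfloor>x * w i\<rfloor> + 1)"

end

theory Submission
  imports Defs
begin

text \<open>
  Two facts carry the proof. The first is arithmetic: distinct finite sets of primes have distinct
  sums of \<open>ln (1 - 1/p)\<close>, because after cancelling common primes and exponentiating, the
  largest remaining prime divides one side of an equation of integers and not the other
  (lemma \<open>inj_on_sum_ln_prime_weights\<close>). Hence the gap \<open>\<delta>\<close> is positive, and
  \<open>\<delta> \<le> w n\<close> because the empty set competes in the minimum.

  The second is that rounding is harmless (lemma \<open>rounded_sums_gap\<close>): scaling by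
  \<open>x > 4n/\<delta>\<close> separates subset sums of \<open>x w\<close> by more than \<open>4n\<close>, taking floors costs
  at most \<open>n\<close>, and after multiplication by \<open>c \<ge> 1\<close> the added units cost at most another
  \<open>n\<close>. So subset sums of the \<open>A i\<close> keep their order and even lie at least 2 apart. This
  leaves room for more than distinctness: a subset with sum \<open>\<lfloor>T/2\<rfloor>\<close>, where
  \<open>T\<close> is the total, would differ from its complement by at most 1.

  A tenth of the indices cannot reach half the total because any two of the \<open>A i\<close> have a ratio
  below 5: with \<open>y = x w n > 4\<close> they all lie between \<open>c (y - 1)\<close> and
  \<open>c (3y/2 + 1)\<close>. For divisors, a number dividing some \<open>A j = c \<lfloor>x w j\<rfloor> + 1\<close> is coprime to
  \<open>c\<close>, while one that also divides \<open>A i = c \<lfloor>x w i\<rfloor>\<close> must then divide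
  \<open>\<lfloor>x w i\<rfloor>\<close> and so \<open>c\<close>. So for \<open>d > 1\<close> the multiples of \<open>d\<close> among the
  \<open>A i\<close> lie entirely within the first \<open>\<lfloor>n/2\<rfloor>\<close> indices or entirely within the others.
\<close>

section \<open>Prime weights have distinct subset sums\<close>

text \<open>
  The largest prime \<open>q\<close> on the right-hand side divides no \<open>p - 1\<close> with \<open>p \<le> q\<close>
  and no prime other than itself, so it cannot divide the left-hand side.
\<close>

lemma prime_prod_pred_neq:
  fixes P Q :: "nat set"
  assumes fin: "finite P" "finite Q"
    and primes: "\<And>p. p \<in> P \<union> Q \<Longrightarrow> prime p"
    and disj: "P \<inter> Q = {}"
    and q: "q \<in> P" "\<And>p. p \<in> P \<union> Q \<Longrightarrow> p \<le> q"
  shows "(\<Prod>p\<in>P. p - 1) * (\<Prod>p\<in>Q. p) \<noteq> (\<Prod>p\<in>Q. p - 1) * (\<Prod>p\<in>P. p)"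
proof
  assume eq: "(\<Prod>p\<in>P. p - 1) * (\<Prod>p\<in>Q. p) = (\<Prod>p\<in>Q. p - 1) * (\<Prod>p\<in>P. p)"
  have pq: "prime q" using primes q by auto
  have "q dvd (\<Prod>p\<in>P. p)" using dvd_prodI[OF fin(1) q(1), of "\<lambda>p. p"] by simp
  then have "q dvd (\<Prod>p\<in>P. p - 1) * (\<Prod>p\<in>Q. p)" unfolding eq by (rule dvd_mult)
  then consider "q dvd (\<Prod>p\<in>P. p - 1)" | "q dvd (\<Prod>p\<in>Q. p)"
    using pq prime_dvd_mult_iff by blast
  then show False
  proof cases
    case 1
    then obtain p where p: "p \<in> P" "q dvd p - 1"
      using fin pq by (auto simp: prime_dvd_prod_iff)
    have "p \<ge> 2" "p \<le> q" using p primes q prime_ge_2_nat by auto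
    then show False using p(2) by (auto dest: dvd_imp_le)
  next
    case 2
    then obtain p where p: "p \<in> Q" "q dvd p"
      using fin pq by (auto simp: prime_dvd_prod_iff)
    then have "q = p" using primes pq by (simp add: primes_dvd_imp_eq)
    then show False using p q disj by auto
  qed
qed

text \<open>
  After the primes common to \<open>P\<close> and \<open>Q\<close> are cancelled, exponentiating and clearing
  denominators gives exactly the equation that the previous lemma excludes, unless no prime is left.
\<close>

lemma inj_on_sum_ln_prime_weights:
  "inj_on (\<lambda>P. \<Sum>p\<in>P. ln (1 - 1 / real p)) {P. finite P \<and> (\<forall>p\<in>P. prime p)}"
proof (rule inj_onI)
  fix P Q :: "nat set"
  assume P: "P \<in> {P. finite P \<and> (\<forall>p\<in>P. prime p)}"
    and Q: "Q \<in> {P. finite P \<and> (\<forall>p\<in>P. prime p)}"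
    and eq: "(\<Sum>p\<in>P. ln (1 - 1 / real p)) = (\<Sum>p\<in>Q. ln (1 - 1 / real p))"
  define D where "D = P - Q"
  define E where "E = Q - P"
  have fin: "finite D" "finite E" and primes: "\<And>p. p \<in> D \<union> E \<Longrightarrow> prime p"
    and disj: "D \<inter> E = {}"
    using P Q by (auto simp: D_def E_def)
  have "(\<Sum>p\<in>D. ln (1 - 1 / real p)) = (\<Sum>p\<in>E. ln (1 - 1 / real p))"
    using eq P Q sum.Int_Diff[of P "\<lambda>p. ln (1 - 1 / real p)" Q]
      sum.Int_Diff[of Q "\<lambda>p. ln (1 - 1 / real p)" P]
    by (simp add: D_def E_def Int_commute)
  then have "exp (\<Sum>p\<in>D. ln (1 - 1 / real p)) = exp (\<Sum>p\<in>E. ln (1 - 1 / real p))"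
    by simp
  moreover have "exp (\<Sum>p\<in>S. ln (1 - 1 / real p)) = (\<Prod>p\<in>S. real (p - 1)) / (\<Prod>p\<in>S. real p)"
    if "S \<subseteq> D \<union> E" for S
  proof -
    have "exp (\<Sum>p\<in>S. ln (1 - 1 / real p)) = (\<Prod>p\<in>S. exp (ln (1 - 1 / real p)))"
      using that fin by (simp add: exp_sum finite_subset)
    also have "\<dots> = (\<Prod>p\<in>S. real (p - 1) / real p)"
    proof (rule prod.cong[OF refl])
      fix p assume "p \<in> S"
      then have "p \<ge> 2" using that primes prime_ge_2_nat by blast
      then show "exp (ln (1 - 1 / real p)) = real (p - 1) / real p"
        by (simp add: of_nat_diff field_simps)
    qed
    finally show ?thesis by (simp add: prod_dividef)
  qed
  moreover have "(\<Prod>p\<in>S. real p) \<noteq> 0" if "S \<subseteq> D \<union> E" for S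
    using that fin primes by (auto simp: prod_zero_iff finite_subset dest!: primes)
  ultimately have "(\<Prod>p\<in>D. real (p - 1)) * (\<Prod>p\<in>E. real p)
      = (\<Prod>p\<in>E. real (p - 1)) * (\<Prod>p\<in>D. real p)"
    by (simp add: frac_eq_eq)
  then have "real ((\<Prod>p\<in>D. p - 1) * (\<Prod>p\<in>E. p)) = real ((\<Prod>p\<in>E. p - 1) * (\<Prod>p\<in>D. p))"
    unfolding of_nat_mult of_nat_prod .
  then have prods: "(\<Prod>p\<in>D. p - 1) * (\<Prod>p\<in>E. p) = (\<Prod>p\<in>E. p - 1) * (\<Prod>p\<in>D. p)"
    unfolding of_nat_eq_iff .
  have "D \<union> E = {}"
  proof (rule ccontr)
    assume ne: "D \<union> E \<noteq> {}"
    define q where "q = Max (D \<union> E)"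
    have q: "q \<in> D \<union> E" "\<And>p. p \<in> D \<union> E \<Longrightarrow> p \<le> q"
      using ne fin by (auto simp: q_def intro: Max_in simp del: Max_Un Un_iff)
    show False
    proof (cases "q \<in> D")
      case True
      then show False
        using prime_prod_pred_neq[OF fin primes disj True q(2)] prods by blast
    next
      case False
      then have "q \<in> E" using q by blast
      then show False
        using prime_prod_pred_neq[of E D q] fin primes disj q prods
        by (auto simp: Un_commute Int_commute)
    qed
  qed
  then show "P = Q" by (auto simp: D_def E_def)
qed

lemma inj_on_sum_prime_weight:
  assumes primes: "\<And>i. i \<in> S \<Longrightarrow> prime (p i)" and "finite S" and inj: "inj_on p S"
  shows "inj_on (\<lambda>I. \<Sum>i\<in>I. prime_weight p i) (Pow S)"
proof (rule inj_onI)
  fix I J assume I: "I \<in> Pow S" and J: "J \<in> Pow S"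
    and eq: "(\<Sum>i\<in>I. prime_weight p i) = (\<Sum>i\<in>J. prime_weight p i)"
  have image: "(\<Sum>q\<in>p ` K. ln (1 - 1 / real q)) = - (\<Sum>i\<in>K. prime_weight p i)" if "K \<in> Pow S" for K
    using that inj_on_subset[OF inj, of K]
    by (simp add: sum.reindex prime_weight_def sum_negf)
  have "p ` I = p ` J"
    using inj_on_sum_ln_prime_weights
  proof (rule inj_onD)
    show "(\<Sum>q\<in>p ` I. ln (1 - 1 / real q)) = (\<Sum>q\<in>p ` J. ln (1 - 1 / real q))"
      using image I J eq by simp
  qed (use I J assms in \<open>auto intro: finite_subset\<close>)
  then show "I = J" using inj I J by (simp add: inj_on_image_eq_iff)
qed

section \<open>The gap between subset sums\<close>

lemma finite_subset_gaps:
  fixes w :: "nat \<Rightarrow> real"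
  shows "finite {\<bar>(\<Sum>i\<in>I. w i) - (\<Sum>j\<in>J. w j)\<bar> | I J. I \<subseteq> {1..n} \<and> J \<subseteq> {1..n} \<and> I \<noteq> J}"
proof (rule finite_subset)
  show "{\<bar>(\<Sum>i\<in>I. w i) - (\<Sum>j\<in>J. w j)\<bar> | I J. I \<subseteq> {1..n} \<and> J \<subseteq> {1..n} \<and> I \<noteq> J}
      \<subseteq> (\<lambda>(I, J). \<bar>(\<Sum>i\<in>I. w i) - (\<Sum>j\<in>J. w j)\<bar>) ` (Pow {1..n} \<times> Pow {1..n})"
    by auto
qed simp

lemma subset_gap_le:
  assumes "I \<subseteq> {1..n}" "J \<subseteq> {1..n}" "I \<noteq> J"
  shows "subset_gap n w \<le> \<bar>(\<Sum>i\<in>I. w i) - (\<Sum>j\<in>J. w j)\<bar>"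
  unfolding subset_gap_def using assms by (intro Min_le finite_subset_gaps) blast

lemma subset_gap_pos:
  assumes "n \<ge> 1" and inj: "inj_on (\<lambda>I. \<Sum>i\<in>I. w i) (Pow {1..n})"
  shows "subset_gap n w > 0"
proof -
  let ?G = "{\<bar>(\<Sum>i\<in>I. w i) - (\<Sum>j\<in>J. w j)\<bar> | I J. I \<subseteq> {1..n} \<and> J \<subseteq> {1..n} \<and> I \<noteq> J}"
  have "\<bar>(\<Sum>i\<in>{1..n}. w i) - (\<Sum>j\<in>{}. w j)\<bar> \<in> ?G"
    using assms(1) by fastforce
  then have "?G \<noteq> {}" by blast
  then have "Min ?G \<in> ?G" by (rule Min_in[OF finite_subset_gaps])
  then obtain I J where IJ: "I \<subseteq> {1..n}" "J \<subseteq> {1..n}" "I \<noteq> J"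
    and eq: "subset_gap n w = \<bar>(\<Sum>i\<in>I. w i) - (\<Sum>j\<in>J. w j)\<bar>"
    unfolding subset_gap_def by blast
  have "(\<Sum>i\<in>I. w i) \<noteq> (\<Sum>j\<in>J. w j)" using inj_onD[OF inj, of I J] IJ by auto
  then show ?thesis by (simp add: eq)
qed

text \<open>
  The scaled sums differ by more than \<open>4N\<close>; where \<open>N = card S\<close>; the floors lose at most
  \<open>N\<close>, leaving \<open>3N\<close>, which multiplication by \<open>c\<close> turns into \<open>3 c N\<close>; the perturbations \<open>e\<close> lose at most \<open>N \<le> c N\<close>, so \<open>2 c N \<ge> 2 N\<close> is left.
\<close>

lemma rounded_sums_gap:
  fixes w :: "'a \<Rightarrow> real" and e :: "'a \<Rightarrow> int" and c :: int
  assumes fin: "finite S" and IJ: "I \<subseteq> S" "J \<subseteq> S"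
    and c: "c \<ge> 1" and e: "\<And>i. i \<in> S \<Longrightarrow> 0 \<le> e i \<and> e i \<le> 1"
    and gap: "x * ((\<Sum>j\<in>J. w j) - (\<Sum>i\<in>I. w i)) > 4 * real (card S)"
  shows "(\<Sum>i\<in>I. c * \<lfloor>x * w i\<rfloor> + e i) + 2 * int (card S) \<le> (\<Sum>j\<in>J. c * \<lfloor>x * w j\<rfloor> + e j)"
proof -
  let ?N = "int (card S)"
  have card: "card K \<le> card S" if "K \<subseteq> S" for K
    using that fin card_mono by blast
  have "real_of_int (\<Sum>i\<in>I. \<lfloor>x * w i\<rfloor>) \<le> x * (\<Sum>i\<in>I. w i)"
    by (simp add: sum_distrib_left sum_mono)
  moreover have "x * (\<Sum>j\<in>J. w j) - real (card J) \<le> real_of_int (\<Sum>j\<in>J. \<lfloor>x * w j\<rfloor>)"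
  proof -
    have "x * (\<Sum>j\<in>J. w j) - real (card J) = (\<Sum>j\<in>J. x * w j - 1)"
      by (simp add: sum_distrib_left sum_subtractf)
    also have "\<dots> \<le> (\<Sum>j\<in>J. real_of_int \<lfloor>x * w j\<rfloor>)"
      by (intro sum_mono) linarith
    finally show ?thesis by simp
  qed
  moreover have "real (card J) \<le> real (card S)" using card IJ by simp
  ultimately have
    "real_of_int (3 * ?N) < real_of_int ((\<Sum>j\<in>J. \<lfloor>x * w j\<rfloor>) - (\<Sum>i\<in>I. \<lfloor>x * w i\<rfloor>))"
    using gap by (simp add: right_diff_distrib)
  then have floors: "3 * ?N \<le> (\<Sum>j\<in>J. \<lfloor>x * w j\<rfloor>) - (\<Sum>i\<in>I. \<lfloor>x * w i\<rfloor>)"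
    unfolding of_int_less_iff by simp
  have "3 * ?N \<le> c * (3 * ?N)" using c by (simp add: mult_le_cancel_right1)
  also have "\<dots> \<le> c * ((\<Sum>j\<in>J. \<lfloor>x * w j\<rfloor>) - (\<Sum>i\<in>I. \<lfloor>x * w i\<rfloor>))"
    using floors c by (intro mult_left_mono) auto
  finally have "3 * ?N \<le> c * (\<Sum>j\<in>J. \<lfloor>x * w j\<rfloor>) - c * (\<Sum>i\<in>I. \<lfloor>x * w i\<rfloor>)"
    by (simp add: right_diff_distrib)
  moreover have "(\<Sum>i\<in>I. e i) \<le> ?N"
  proof -
    have "(\<Sum>i\<in>I. e i) \<le> (\<Sum>i\<in>I. 1)" using e IJ by (intro sum_mono) auto
    then show ?thesis using card[OF IJ(1)] by simp
  qed
  moreover have "0 \<le> (\<Sum>j\<in>J. e j)" using e IJ by (intro sum_nonneg) auto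
  ultimately show ?thesis by (simp add: sum.distrib sum_distrib_left)
qed

section \<open>Small subsets, common divisors and the halving sum\<close>

text \<open>
  A tenth of the terms at the upper bound is compared with half of all terms at the lower bound;
  \<open>(3y/2 + 1)/10 < (y - 1)/2\<close> is equivalent to \<open>y > 12/7\<close>.
\<close>

lemma tenth_sum_less_half:
  fixes a :: "'a \<Rightarrow> real"
  assumes fin: "finite S" "S \<noteq> {}" and I: "I \<subseteq> S" "10 * card I \<le> card S"
    and "c > 0" "y > 12 / 7"
    and lower: "\<And>i. i \<in> S \<Longrightarrow> c * (y - 1) \<le> a i"
    and upper: "\<And>i. i \<in> S \<Longrightarrow> a i \<le> c * (3 / 2 * y + 1)"
  shows "(\<Sum>i\<in>I. a i) < 1 / 2 * (\<Sum>i\<in>S. a i)"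
proof -
  have N: "real (card S) > 0" using fin by (simp add: card_gt_0_iff)
  have "(\<Sum>i\<in>I. a i) \<le> real (card I) * (c * (3 / 2 * y + 1))"
    using upper I by (intro sum_bounded_above) auto
  also have "\<dots> \<le> (real (card S) / 10) * (c * (3 / 2 * y + 1))"
    using assms by (intro mult_right_mono) auto
  also have "\<dots> = (real (card S) * c) * ((3 / 2 * y + 1) / 10)" by simp
  also have "\<dots> < (real (card S) * c) * ((y - 1) / 2)"
    using N assms by (intro mult_strict_left_mono) auto
  also have "\<dots> = 1 / 2 * (real (card S) * (c * (y - 1)))" by simp
  also have "\<dots> \<le> 1 / 2 * (\<Sum>i\<in>S. a i)"
    using sum_bounded_below[of S "c * (y - 1)" a] lower by simp
  finally show ?thesis .
qed

text \<open>
  Dividing a term \<open>c * b j + 1\<close> makes \<open>d\<close> coprime to \<open>c\<close>. Dividing also a term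
  \<open>c * b i\<close> with \<open>i \<le> m\<close> would then put \<open>d\<close> into \<open>b i\<close>, a divisor of \<open>c\<close>.
  Hence the multiples of \<open>d\<close> never occur on both sides of \<open>m\<close>.
\<close>

lemma card_common_divisor_le:
  fixes b :: "nat \<Rightarrow> int" and d :: int
  assumes "d > 1" and b: "\<And>i. i \<in> {1..m} \<Longrightarrow> b i dvd c"
  shows "card {i \<in> {1..n}. d dvd (if i \<le> m then c * b i else c * b i + 1)} \<le> max m (n - m)"
    (is "card ?D \<le> _")
proof (cases "?D \<subseteq> {1..m}")
  case True
  then have "card ?D \<le> card {1..m}" by (intro card_mono) auto
  then show ?thesis by simp
next
  case False
  then obtain j where "j \<in> ?D" "j \<notin> {1..m}" by blast
  then have "d dvd c * b j + 1" by auto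
  then have cop: "coprime d c"
    by (meson coprimeI dvd_add_right_iff dvd_mult2 dvd_trans)
  have "?D \<subseteq> {m<..n}"
  proof
    fix i assume i: "i \<in> ?D"
    have False if "i \<le> m"
    proof -
      have "d dvd b i" using i that cop by (simp add: coprime_dvd_mult_right_iff)
      then have "d dvd c" using b[of i] i that dvd_trans by auto
      then have "is_unit d" using cop by (simp add: coprime_absorb_left)
      then show False using \<open>d > 1\<close> by simp
    qed
    then show "i \<in> {m<..n}" using i by force
  qed
  then have "card ?D \<le> card {m<..n}" by (intro card_mono) auto
  then show ?thesis by simp
qed

text \<open>
  A subset with sum \<open>\<lfloor>T/2\<rfloor>\<close>, where \<open>T\<close> is the total, leaves \<open>\<lceil>T/2\<rceil>\<close> to its complement,
  so these two sums are at most 1 apart.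
\<close>

lemma no_halving_subset:
  fixes a :: "'a \<Rightarrow> int"
  assumes "finite S" "S \<noteq> {}"
    and far: "\<And>I J. I \<subseteq> S \<Longrightarrow> J \<subseteq> S \<Longrightarrow> I \<noteq> J \<Longrightarrow> \<bar>(\<Sum>i\<in>I. a i) - (\<Sum>j\<in>J. a j)\<bar> \<ge> 2"
    and "I \<subseteq> S"
  shows "(\<Sum>i\<in>I. a i) \<noteq> \<lfloor>1 / 2 * real_of_int (\<Sum>i\<in>S. a i)\<rfloor>"
proof
  assume half: "(\<Sum>i\<in>I. a i) = \<lfloor>1 / 2 * real_of_int (\<Sum>i\<in>S. a i)\<rfloor>"
  have "S - I \<noteq> I" using assms by auto
  then have "\<bar>(\<Sum>i\<in>S - I. a i) - (\<Sum>i\<in>I. a i)\<bar> \<ge> 2" using far assms by auto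
  moreover have "(\<Sum>i\<in>S. a i) = (\<Sum>i\<in>S - I. a i) + (\<Sum>i\<in>I. a i)"
    using assms by (intro sum.subset_diff) auto
  moreover have "(\<Sum>i\<in>I. a i) = (\<Sum>i\<in>S. a i) div 2"
    using half floor_divide_of_int_eq[of "\<Sum>i\<in>S. a i" 2, where 'a = real] by simp
  ultimately show False by linarith
qed

section \<open>The integer weights\<close>

theorem proposition6:
  fixes n :: nat and X x :: real and p :: "nat \<Rightarrow> nat"
    and w :: "nat \<Rightarrow> real" and A :: "nat \<Rightarrow> int"
  defines "w \<equiv> prime_weight p"
    and "A \<equiv> int_weight n w x"
  assumes n_pos: "n \<ge> 1"
    and X_pos: "X > 0"
    and primes: "\<And>i. i \<in> {1..n} \<Longrightarrow> prime (p i)"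
    and distinct: "inj_on p {1..n}"
    and range: "\<And>i. i \<in> {1..n} \<Longrightarrow> real (p i) \<in> {X .. 5 * X / 4}"
    and decreasing: "\<And>i j. 1 \<le> i \<Longrightarrow> i \<le> j \<Longrightarrow> j \<le> n \<Longrightarrow> w j \<le> w i"
    and last_pos: "w n > 0"
    and ratio: "w 1 / w n < 3 / 2"
    and x_large: "x > 4 * real n / subset_gap n w"
  shows
    "(\<forall>I J. I \<subseteq> {1..n} \<and> J \<subseteq> {1..n} \<and> I \<noteq> J \<longrightarrow>
        (\<Sum>i\<in>I. w i) \<noteq> (\<Sum>j\<in>J. w j) \<and>
        (\<Sum>i\<in>I. A i) \<noteq> (\<Sum>j\<in>J. A j) \<and>
        ((\<Sum>i\<in>I. w i) < (\<Sum>j\<in>J. w j) \<longleftrightarrow> (\<Sum>i\<in>I. A i) < (\<Sum>j\<in>J. A j)))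
   \<and> (\<forall>I. I \<subseteq> {1..n} \<and> 10 * card I \<le> n \<longrightarrow>
        real_of_int (\<Sum>i\<in>I. A i) < 1 / 2 * real_of_int (\<Sum>i=1..n. A i))
   \<and> (\<forall>d::int. d > 1 \<longrightarrow> int (card {i \<in> {1..n}. d dvd A i}) \<le> \<lceil>real n / 2\<rceil>)
   \<and> (\<forall>I J. I \<subseteq> {1..n} \<and> J \<subseteq> {1..n} \<and> I \<noteq> J \<longrightarrow> (\<Sum>i\<in>I. A i) \<noteq> (\<Sum>j\<in>J. A j))
   \<and> \<not> (\<exists>I. I \<subseteq> {1..n} \<and> (\<Sum>i\<in>I. A i) = \<lfloor>1 / 2 * real_of_int (\<Sum>i=1..n. A i)\<rfloor>)"
proof -
  define m where "m = n div 2"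
  define c where "c = common_multiple m w x"
  define e :: "nat \<Rightarrow> int" where "e = (\<lambda>i. if i \<le> m then 0 else 1)"
  define b where "b = (\<lambda>i. \<lfloor>x * w i\<rfloor>)"
  have A_eq: "A i = c * b i + e i" for i
    unfolding A_def int_weight_def c_def m_def e_def b_def Let_def by simp
  have inj: "inj_on (\<lambda>I. \<Sum>i\<in>I. w i) (Pow {1..n})"
    unfolding w_def using primes distinct by (intro inj_on_sum_prime_weight) auto
  have gap_pos: "subset_gap n w > 0" using subset_gap_pos[OF n_pos inj] .
  then have scaled: "x * subset_gap n w > 4 * real n"
    using x_large by (simp add: pos_divide_less_eq)
  have x_pos: "x > 0" using x_large gap_pos
    by (meson divide_nonneg_pos le_less_trans mult_nonneg_nonneg of_nat_0_le_iff zero_le_numeral)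
  have "subset_gap n w \<le> w n"
    using subset_gap_le[of "{n}" n "{}" w] n_pos last_pos by simp
  then have "x * subset_gap n w \<le> x * w n" using x_pos by simp
  then have y_large: "x * w n > 4"
    using scaled n_pos by linarith
  have w_bounds: "w n \<le> w i" "w i \<le> 3 / 2 * w n" if "i \<in> {1..n}" for i
  proof -
    show "w n \<le> w i" using decreasing[of i n] that by simp
    have "w i \<le> w 1" using decreasing[of 1 i] that by simp
    also have "\<dots> \<le> 3 / 2 * w n" using ratio last_pos by (simp add: pos_divide_less_eq)
    finally show "w i \<le> 3 / 2 * w n" .
  qed
  have xw: "x * w n \<le> x * w i" "x * w i \<le> 3 / 2 * (x * w n)" if "i \<in> {1..n}" for i
    using mult_left_mono[OF w_bounds(1)[OF that], of x]
      mult_left_mono[OF w_bounds(2)[OF that], of x] x_pos by auto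
  have b_bounds: "x * w n - 1 \<le> real_of_int (b i)" "real_of_int (b i) \<le> 3 / 2 * (x * w n)"
    if "i \<in> {1..n}" for i
    using xw[OF that] unfolding b_def by linarith+
  have b_pos: "b i > 0" if "i \<in> {1..n}" for i
    using b_bounds(1)[OF that] y_large by linarith
  have c_pos: "c \<ge> 1"
  proof -
    have "b i \<noteq> 0" if "i \<in> {1..m}" for i
    proof -
      have "m \<le> n" unfolding m_def by simp
      then show ?thesis using b_pos[of i] that by auto
    qed
    then have "0 \<notin> b ` {1..m}" by force
    then have "c \<noteq> 0"
      unfolding c_def common_multiple_def b_def by (subst Lcm_0_iff) auto
    moreover have "c \<ge> 0" unfolding c_def common_multiple_def by simp
    ultimately show ?thesis by linarith
  qed
  have e_range: "0 \<le> e i \<and> e i \<le> 1" for i by (simp add: e_def)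

  have w_neq: "(\<Sum>i\<in>I. w i) \<noteq> (\<Sum>j\<in>J. w j)" if "I \<subseteq> {1..n}" "J \<subseteq> {1..n}" "I \<noteq> J" for I J
    using inj_onD[OF inj, of I J] that by auto
  have ordered: "(\<Sum>i\<in>I. A i) + 2 \<le> (\<Sum>j\<in>J. A j)"
    if IJ: "I \<subseteq> {1..n}" "J \<subseteq> {1..n}" "I \<noteq> J" and less: "(\<Sum>i\<in>I. w i) < (\<Sum>j\<in>J. w j)" for I J
  proof -
    have "subset_gap n w \<le> (\<Sum>j\<in>J. w j) - (\<Sum>i\<in>I. w i)"
      using subset_gap_le[OF IJ, of w] less by simp
    then have "x * subset_gap n w \<le> x * ((\<Sum>j\<in>J. w j) - (\<Sum>i\<in>I. w i))"
      using x_pos by simp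
    then have "x * ((\<Sum>j\<in>J. w j) - (\<Sum>i\<in>I. w i)) > 4 * real (card {1..n})"
      using scaled by simp
    then have "(\<Sum>i\<in>I. c * \<lfloor>x * w i\<rfloor> + e i) + 2 * int (card {1..n})
        \<le> (\<Sum>j\<in>J. c * \<lfloor>x * w j\<rfloor> + e j)"
      using IJ c_pos e_range by (intro rounded_sums_gap) auto
    then show ?thesis
      using n_pos by (simp add: A_eq b_def)
  qed
  have far: "\<bar>(\<Sum>i\<in>I. A i) - (\<Sum>j\<in>J. A j)\<bar> \<ge> 2"
    if "I \<subseteq> {1..n}" "J \<subseteq> {1..n}" "I \<noteq> J" for I J
    using ordered[of I J] ordered[of J I] w_neq[of I J] that
    by (cases "(\<Sum>i\<in>I. w i) < (\<Sum>j\<in>J. w j)") auto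

  have order: "(\<Sum>i\<in>I. w i) < (\<Sum>j\<in>J. w j) \<longleftrightarrow> (\<Sum>i\<in>I. A i) < (\<Sum>j\<in>J. A j)"
    if "I \<subseteq> {1..n}" "J \<subseteq> {1..n}" "I \<noteq> J" for I J
    using ordered[of I J] ordered[of J I] w_neq[of I J] that by force
  have A_neq: "(\<Sum>i\<in>I. A i) \<noteq> (\<Sum>j\<in>J. A j)" if "I \<subseteq> {1..n}" "J \<subseteq> {1..n}" "I \<noteq> J" for I J
    using far[OF that] by auto
  have small: "real_of_int (\<Sum>i\<in>I. A i) < 1 / 2 * real_of_int (\<Sum>i=1..n. A i)"
    if I: "I \<subseteq> {1..n}" "10 * card I \<le> n" for I
  proof -
    have cr: "real_of_int c \<ge> 1" using c_pos by simp
    have A_bounds: "real_of_int c * (x * w n - 1) \<le> real_of_int (A i)"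
      "real_of_int (A i) \<le> real_of_int c * (3 / 2 * (x * w n) + 1)"
      if i: "i \<in> {1..n}" for i
    proof -
      have "real_of_int c * (x * w n - 1) \<le> real_of_int c * real_of_int (b i)"
        using b_bounds(1)[OF i] cr by (intro mult_left_mono) auto
      moreover have "real_of_int c * real_of_int (b i) \<le> real_of_int c * (3 / 2 * (x * w n))"
        using b_bounds(2)[OF i] cr by (intro mult_left_mono) auto
      moreover have "real_of_int (A i) = real_of_int c * real_of_int (b i) + real_of_int (e i)"
        by (simp add: A_eq)
      moreover have "0 \<le> real_of_int (e i)" "real_of_int (e i) \<le> 1"
        using e_range[of i] by auto
      moreover have "real_of_int c * (3 / 2 * (x * w n) + 1)
          = real_of_int c * (3 / 2 * (x * w n)) + real_of_int c"
        by (simp only: distrib_left mult_1_right)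
      ultimately show "real_of_int c * (x * w n - 1) \<le> real_of_int (A i)"
        "real_of_int (A i) \<le> real_of_int c * (3 / 2 * (x * w n) + 1)"
        using cr by linarith+
    qed
    have "(\<Sum>i\<in>I. real_of_int (A i)) < 1 / 2 * (\<Sum>i\<in>{1..n}. real_of_int (A i))"
    proof (rule tenth_sum_less_half[OF _ _ I(1) _ _ _ A_bounds])
      show "10 * card I \<le> card {1..n}" using I(2) by simp
    qed (use n_pos cr y_large in auto)
    then show ?thesis by simp
  qed
  have divisors: "int (card {i \<in> {1..n}. d dvd A i}) \<le> \<lceil>real n / 2\<rceil>" if "d > 1" for d :: int
  proof -
    have "b i dvd c" if "i \<in> {1..m}" for i
      unfolding c_def common_multiple_def b_def using that by (intro dvd_Lcm) auto
    then have "card {i \<in> {1..n}. d dvd (if i \<le> m then c * b i else c * b i + 1)} \<le> max m (n - m)"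
      using \<open>d > 1\<close> by (intro card_common_divisor_le)
    moreover have "A i = (if i \<le> m then c * b i else c * b i + 1)" for i
      by (simp add: A_eq e_def)
    moreover have "int (max m (n - m)) \<le> \<lceil>real n / 2\<rceil>"
    proof -
      have "2 * max m (n - m) \<le> n + 1" unfolding m_def by linarith
      then have "real (max m (n - m)) - 1 < real n / 2" by linarith
      then show ?thesis by linarith
    qed
    ultimately show ?thesis by simp
  qed
  have no_half: "(\<Sum>i\<in>I. A i) \<noteq> \<lfloor>1 / 2 * real_of_int (\<Sum>i=1..n. A i)\<rfloor>" if "I \<subseteq> {1..n}" for I
    using n_pos by (intro no_halving_subset far that) auto
  show ?thesis
    by (intro conjI allI impI)
      ((rule w_neq A_neq order small divisors; blast) | (use no_half in blast))+
qed

end
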